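(* Let $J(x,y,w)=\sum_{n\ge1}\sum_{\sigma\in S_n(T_1)}x^ny^{pos(\sigma)}w^{lmax(\sigma)}$ and $B(x,y,w)=\sum_{n\ge1}\sum_{\sigma\in S_n(T_1),\,\sigma(n)=n}x^ny^{pos(\sigma)}w^{lmax(\sigma)}$. Then $$J(x,y,w)=\frac{B(x,y,w)\bigl(B(x,y,w)-yw\bigr)}{2B(x,y,w)-yw}.$$
   Context: A permutation $\sigma$ avoids $\tau$ if no subsequence of $\sigma$ has the same relative order as $\tau$. $T_1=\{3214,3241,4213,4231\}$ and $S_n(T_1)$ is the set of permutations in $S_n$ avoiding all four patterns. $pos(\sigma)$ is the position of the maximum entry of $\sigma$, and $lmax(\sigma)$ is the number of left-to-right maxima of $\sigma$ (entries larger than all preceding entries). Generating functions are formal power series. *)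

theory Defs
  imports
    "HOL-Library.Sublist"
    "HOL-Combinatorics.Multiset_Permutations"
    "HOL-Computational_Algebra.Computational_Algebra"
begin

text \<open>
  Permutations of \<open>{1..n}\<close> are given in one-line notation, as the lists in
  \<^term>\<open>permutations_of_set {1..n}\<close>. List indices start at 0, positions start at 1.
\<close>

definition same_order :: "nat list \<Rightarrow> nat list \<Rightarrow> bool" where
  "same_order xs ys \<longleftrightarrow> length xs = length ys \<and>
     (\<forall>i<length xs. \<forall>j<length xs. xs ! i < xs ! j \<longleftrightarrow> ys ! i < ys ! j)"

definition avoids :: "nat list \<Rightarrow> nat list \<Rightarrow> bool" where
  "avoids \<sigma> \<tau> \<longleftrightarrow> \<not> (\<exists>\<rho>. subseq \<rho> \<sigma> \<and> same_order \<rho> \<tau>)"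

definition Av :: "nat list set \<Rightarrow> nat \<Rightarrow> nat list set" where
  "Av T n = {\<sigma> \<in> permutations_of_set {1..n}. \<forall>\<tau>\<in>T. avoids \<sigma> \<tau>}"

definition T1 :: "nat list set" where
  "T1 = {[3,2,1,4], [3,2,4,1], [4,2,1,3], [4,2,3,1]}"

text \<open>For a nonempty list with distinct entries the index below is unique.\<close>

definition pos :: "nat list \<Rightarrow> nat" where
  "pos \<sigma> = Suc (THE i. i < length \<sigma> \<and> \<sigma> ! i = Max (set \<sigma>))"

definition lmax :: "nat list \<Rightarrow> nat" where
  "lmax \<sigma> = card {i. i < length \<sigma> \<and> (\<forall>j<i. \<sigma> ! j < \<sigma> ! i)}"

text \<open>
  The power series ring in \<open>x, y, w\<close> over the integers is represented as the iterated power
  series ring with \<open>x\<close> the outermost and \<open>w\<close> the innermost variable.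
\<close>

type_synonym fps3 = "int fps fps fps"

definition varY :: "int fps fps" where "varY = fps_X"

definition varW :: "int fps fps" where "varW = fps_const fps_X"

text \<open>
  \<open>gf P\<close> is the sum over all \<open>n \<ge> 1\<close> and \<open>\<sigma> \<in> P n\<close> of \<open>x^n y^pos(\<sigma>) w^lmax(\<sigma>)\<close>, given by its
  coefficients with respect to \<open>x\<close>.
\<close>

definition gf :: "(nat \<Rightarrow> nat list set) \<Rightarrow> fps3" where
  "gf P = Abs_fps (\<lambda>n. if n = 0 then 0 else (\<Sum>\<sigma>\<in>P n. varY ^ pos \<sigma> * varW ^ lmax \<sigma>))"

definition J :: fps3 where
  "J = gf (Av T1)"

definition B :: fps3 where
  "B = gf (\<lambda>n. {\<sigma> \<in> Av T1 n. \<sigma> ! (n - 1) = n})"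

definition yw :: fps3 where
  "yw = fps_const (varY * varW)"

text \<open>
  The series \<open>2 B - y w\<close> has zero constant term, so it is not a unit in the power series ring,
  but it is nonzero and may be inverted in the fraction field of that ring.
\<close>

lemma denominator_nonzero: "2 * B - yw \<noteq> 0"
proof
  assume "2 * B - yw = 0"
  then have "fps_nth (2 * B - yw) 0 = 0" by simp
  moreover have "fps_nth (2 * B - yw) 0 = - (varY * varW)"
    by (simp add: B_def gf_def yw_def)
  ultimately show False by (simp add: varY_def varW_def)
qed

end

theory Submission
  imports Defs
begin

text \<open>
  A permutation avoids \<open>T1\<close> iff every entry that is not a left-to-right maximum is the least or
  the greatest entry of the suffix starting at it. Write \<open>\<sigma> = q n r\<close> with \<open>n\<close> the maximum. No
  entry of \<open>q\<close> can exceed everything after it, so each entry of \<open>q\<close> is a left-to-right maximum or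
  the least value not used before; and the \<open>m\<close> remaining values can be arranged in \<open>r\<close> in
  \<open>2^(m-1)\<close> ways if \<open>m > 0\<close>. Hence \<open>J\<close> is \<open>B = C_0\<close> plus the sum of \<open>2^(m-1) C_m\<close> over \<open>m > 0\<close>,
  where \<open>C_m\<close> enumerates the words \<open>q\<close> leaving \<open>m\<close> values unused. The \<open>C_m\<close> satisfy a linear
  recurrence of order two in \<open>m\<close>, which together with the divisibility of \<open>C_m\<close> by \<open>x^(m+1)\<close>
  forces \<open>y w C_m = B C_(m-1)\<close>. Summing the geometric series gives
  \<open>y w (J - B) = B (2 J - B)\<close>.
\<close>

section \<open>Pattern avoidance as a condition on each entry\<close>

lemma same_order_4:
  "same_order [p, b, c, d] [i, j, k, l] \<longleftrightarrow>
     (p < b \<longleftrightarrow> i < j) \<and> (p < c \<longleftrightarrow> i < k) \<and> (p < d \<longleftrightarrow> i < l) \<and>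
     (b < p \<longleftrightarrow> j < i) \<and> (b < c \<longleftrightarrow> j < k) \<and> (b < d \<longleftrightarrow> j < l) \<and>
     (c < p \<longleftrightarrow> k < i) \<and> (c < b \<longleftrightarrow> k < j) \<and> (c < d \<longleftrightarrow> k < l) \<and>
     (d < p \<longleftrightarrow> l < i) \<and> (d < b \<longleftrightarrow> l < j) \<and> (d < c \<longleftrightarrow> l < k)"
proof -
  have "x < 4 \<longleftrightarrow> x = 0 \<or> x = 1 \<or> x = 2 \<or> x = 3" for x :: nat
    by auto
  then have all4: "(\<forall>x<4. P x) \<longleftrightarrow> P 0 \<and> P 1 \<and> P 2 \<and> P 3" for P :: "nat \<Rightarrow> bool"
    by metis
  have "length [p, b, c, d] = 4" "length [i, j, k, l] = 4"
    by simp_all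
  then show ?thesis
    unfolding same_order_def by (simp only: all4) (simp add: conj_ac)
qed

lemma length_4_conv: "length xs = 4 \<longleftrightarrow> (\<exists>p b c d. xs = [p, b, c, d])"
  by (auto simp: numeral_eq_Suc length_Suc_conv)

lemma subseq_pair:
  assumes "c \<in> set v" "d \<in> set v" "c \<noteq> d"
  shows "subseq [c, d] v \<or> subseq [d, c] v"
proof -
  obtain v1 v2 where v: "v = v1 @ c # v2"
    using assms(1) by (meson split_list)
  then consider "d \<in> set v1" | "d \<in> set v2"
    using assms by auto
  then show ?thesis
  proof cases
    case 1
    then have "subseq ([d] @ [c]) (v1 @ (c # v2))"
      by (intro list_emb_append_mono) (auto simp: subseq_singleton_left)
    then show ?thesis using v by simp
  next
    case 2
    then have "subseq ([c] @ [d]) ((v1 @ [c]) @ v2)"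
      by (intro list_emb_append_mono) (auto simp: subseq_singleton_left)
    then show ?thesis using v by simp
  qed
qed

text \<open>In each of the four patterns the second entry is below the first and lies strictly
  between the last two in value, and the patterns run through all orders of this kind. So an
  occurrence is an entry with a larger entry before it and both a smaller and a larger one after
  it.\<close>

lemma avoids_T1_iff:
  assumes "distinct \<sigma>"
  shows "(\<forall>\<tau>\<in>T1. avoids \<sigma> \<tau>) \<longleftrightarrow>
    (\<forall>u a v. \<sigma> = u @ a # v \<longrightarrow>
      (\<forall>b\<in>set u. b < a) \<or> (\<forall>b\<in>set v. a < b) \<or> (\<forall>b\<in>set v. b < a))"
proof
  assume L: "\<forall>\<tau>\<in>T1. avoids \<sigma> \<tau>"
  show "\<forall>u a v. \<sigma> = u @ a # v \<longrightarrow>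
      (\<forall>b\<in>set u. b < a) \<or> (\<forall>b\<in>set v. a < b) \<or> (\<forall>b\<in>set v. b < a)"
  proof (intro allI impI, rule ccontr)
    fix u a v
    assume \<sigma>: "\<sigma> = u @ a # v"
      and "\<not> ((\<forall>b\<in>set u. b < a) \<or> (\<forall>b\<in>set v. a < b) \<or> (\<forall>b\<in>set v. b < a))"
    then obtain x c d where x: "x \<in> set u" "\<not> x < a" and c: "c \<in> set v" "\<not> a < c"
      and d: "d \<in> set v" "\<not> d < a" by blast
    have neq: "x \<noteq> a" "c \<noteq> a" "d \<noteq> a" "x \<noteq> d" "x \<noteq> c"
      using assms \<sigma> x c d by auto
    then have less: "a < x" "c < a" "a < d"
      using x c d by auto
    have emb: "subseq ([x] @ [a] @ w) (u @ [a] @ v)" if "subseq w v" for w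
      using x(1) that by (intro list_emb_append_mono) (auto simp: subseq_singleton_left)
    have "subseq [c, d] v \<or> subseq [d, c] v"
      using subseq_pair[OF c(1) d(1)] less by auto
    then have sub: "subseq [x, a, c, d] \<sigma> \<or> subseq [x, a, d, c] \<sigma>"
      using emb \<sigma> by auto
    have avo: "\<not> (subseq \<rho> \<sigma> \<and> same_order \<rho> \<tau>)" if "\<tau> \<in> T1" for \<rho> \<tau>
      using L that unfolding avoids_def by blast
    show False
    \<comment> \<open>Comparing \<open>x\<close> with \<open>d\<close> decides whether the pattern
      starts with 3 or with 4.\<close>
    proof (cases "x < d")
      case True
      then show False
        using sub avo[of "[3,2,1,4]" "[x,a,c,d]"] avo[of "[3,2,4,1]" "[x,a,d,c]"] less
        by (auto simp: T1_def same_order_4)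
    next
      case False
      then show False
        using sub avo[of "[4,2,1,3]" "[x,a,c,d]"] avo[of "[4,2,3,1]" "[x,a,d,c]"] less neq
        by (auto simp: T1_def same_order_4)
    qed
  qed
next
  assume R: "\<forall>u a v. \<sigma> = u @ a # v \<longrightarrow>
      (\<forall>b\<in>set u. b < a) \<or> (\<forall>b\<in>set v. a < b) \<or> (\<forall>b\<in>set v. b < a)"
  show "\<forall>\<tau>\<in>T1. avoids \<sigma> \<tau>"
  proof (rule ballI, unfold avoids_def, rule notI, elim exE conjE)
    fix \<tau> \<rho>
    assume \<tau>: "\<tau> \<in> T1" and sub: "subseq \<rho> \<sigma>" and so: "same_order \<rho> \<tau>"
    from \<tau> so have "length \<rho> = 4"
      by (auto simp: T1_def same_order_def)
    then obtain x a c d where \<rho>: "\<rho> = [x, a, c, d]"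
      by (auto simp: length_4_conv)
    have ord: "a < x \<and> (c < a \<and> a < d \<or> d < a \<and> a < c)"
      using \<tau> so by (auto simp: T1_def \<rho> same_order_4)
    obtain u1 u2 where 1: "\<sigma> = u1 @ x # u2" "subseq [a, c, d] u2"
      using list_emb_ConsD[OF sub[unfolded \<rho>]] by blast
    obtain v1 v2 where 2: "u2 = v1 @ a # v2" "subseq [c, d] v2"
      using list_emb_ConsD[OF 1(2)] by blast
    have "c \<in> set v2"
      by (rule list_emb_set[OF 2(2), of c]) simp_all
    moreover have "d \<in> set v2"
      by (rule list_emb_set[OF 2(2), of d]) simp_all
    moreover have "\<sigma> = (u1 @ x # v1) @ a # v2"
      using 1 2 by simp
    ultimately show False
      using R ord by (metis in_set_conv_decomp not_less_iff_gr_or_eq)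
  qed
qed

section \<open>Words that can precede the maximum\<close>

text \<open>
  An entry is admissible if it is a left-to-right maximum or the least value of \<open>V\<close> that is
  not yet used.
\<close>

definition greedy :: "nat set \<Rightarrow> nat list \<Rightarrow> bool" where
  "greedy V q \<longleftrightarrow> distinct q \<and> set q \<subseteq> V \<and>
     (\<forall>u a v. q = u @ a # v \<longrightarrow> (\<forall>b\<in>set u. b < a) \<or> (\<forall>b\<in>V - set u. a \<le> b))"

definition words :: "nat \<Rightarrow> nat \<Rightarrow> nat list set" where
  "words k m = {q. greedy {1..k} q \<and> length q + m = k}"

lemma finite_words: "finite (words k m)"
proof (rule finite_subset)
  show "words k m \<subseteq> {q. set q \<subseteq> {1..k} \<and> length q \<le> k}"
    by (auto simp: words_def greedy_def)
qed (simp add: finite_lists_length_le)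

lemma words_empty: "k < m \<Longrightarrow> words k m = {}"
  by (auto simp: words_def)

lemma snoc_eq_append_Cons_iff:
  "q @ [x] = u @ a # v \<longleftrightarrow> v = [] \<and> u = q \<and> a = x \<or> (\<exists>v'. v = v' @ [x] \<and> q = u @ a # v')"
  by (cases v rule: rev_cases) auto

lemma greedy_snoc:
  "greedy V (q @ [x]) \<longleftrightarrow>
     greedy V q \<and> x \<in> V - set q \<and> ((\<forall>b\<in>set q. b < x) \<or> (\<forall>b\<in>V - set q. x \<le> b))"
  unfolding greedy_def snoc_eq_append_Cons_iff by auto blast+

lemma greedy_Suc_iff:
  assumes "Suc k \<notin> set q"
  shows "greedy {1..Suc k} q \<longleftrightarrow> greedy {1..k} q"
  using assms
proof (induction q rule: rev_induct)
  case Nil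
  then show ?case by (simp add: greedy_def)
next
  case (snoc x q)
  then show ?case
    by (auto simp: greedy_snoc le_Suc_eq)
qed

lemma words_Suc_iff:
  "Suc k \<notin> set q \<Longrightarrow> q \<in> words (Suc k) (Suc m) \<longleftrightarrow> q \<in> words k m"
  by (auto simp: words_def greedy_Suc_iff simp del: One_nat_def)

lemma not_in_words: "q \<in> words k m \<Longrightarrow> Suc k \<notin> set q"
  by (auto simp: words_def greedy_def)

section \<open>Left-to-right maxima of words and their weighted count\<close>

lemma lmax_append_max:
  assumes "\<forall>b\<in>set q. b < x" "\<forall>b\<in>set r. b < x"
  shows "lmax (q @ x # r) = Suc (lmax q)"
proof -
  have "{i. i < length (q @ x # r) \<and> (\<forall>j<i. (q @ x # r) ! j < (q @ x # r) ! i)} =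
      insert (length q) {i. i < length q \<and> (\<forall>j<i. q ! j < q ! i)}" (is "?L = ?R")
  proof (intro set_eqI)
    fix i
    consider "i < length q" | "i = length q" | k where "i = Suc (length q + k)"
      by (metis less_imp_Suc_add linorder_neqE_nat)
    then show "i \<in> ?L \<longleftrightarrow> i \<in> ?R"
    proof cases
      case 1
      then show ?thesis by (auto simp: nth_append)
    next
      case 2
      then show ?thesis using assms by (auto simp: nth_append)
    next
      case 3
      have "\<not> (q @ x # r) ! length q < (q @ x # r) ! i" if "i < length (q @ x # r)"
      proof -
        have "k < length r" using that 3 by simp
        then have "r ! k < x" using assms(2) by auto
        then show ?thesis by (simp add: 3 nth_append)
      qed
      then show ?thesis using 3 by (auto intro!: exI[of _ "length q"])
    qed
  qed
  then show ?thesis by (simp add: lmax_def)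
qed

lemma lmax_snoc_not_max:
  assumes "b \<in> set q" "x \<le> b"
  shows "lmax (q @ [x]) = lmax q"
proof -
  obtain j where j: "j < length q" "q ! j = b"
    using assms(1) by (auto simp: in_set_conv_nth)
  have "{i. i < length (q @ [x]) \<and> (\<forall>j<i. (q @ [x]) ! j < (q @ [x]) ! i)} =
      {i. i < length q \<and> (\<forall>j<i. q ! j < q ! i)}"
    using j assms(2) by (auto simp: nth_append less_Suc_eq)
  then show ?thesis by (simp add: lmax_def)
qed

text \<open>Only left-to-right maxima are tracked: all words in \<open>words k m\<close> have length
  \<open>k - m\<close>, hence give the same position of the maximum.\<close>

definition weight :: "'a \<Rightarrow> nat \<Rightarrow> nat \<Rightarrow> 'a :: comm_ring_1" where
  "weight t k m = (\<Sum>q\<in>words k m. t ^ lmax q)"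

lemma weight_eq_0: "k < m \<Longrightarrow> weight t k m = 0"
  by (simp add: weight_def words_empty)

text \<open>
  A word over \<open>{1..k+1}\<close> omits \<open>k+1\<close>, or ends in it, or arises from a word that already
  contains \<open>k+1\<close> by appending the least unused value.
\<close>

lemma weight_Suc:
  "weight t (Suc k) m = (if m = 0 then 0 else weight t k (m - 1)) + t * weight t k m
     + (weight t (Suc k) (Suc m) - weight t k m)"
proof -
  define W where "W = words (Suc k) m"
  define W1 where "W1 = {q \<in> W. Suc k \<notin> set q}"
  define W2 where "W2 = (\<lambda>q. q @ [Suc k]) ` words k m"
  \<comment> \<open>\<open>words k m\<close> consists of the words in
    \<open>words (Suc k) (Suc m)\<close> that omit \<open>Suc k\<close>, so \<open>R\<close> holds
    those that contain it. The inclusion turns the sum over \<open>R\<close> into a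
    difference.\<close>
  define R where "R = words (Suc k) (Suc m) - words k m"
  define f where "f r = r @ [Min ({1..Suc k} - set r)]" for r
  have mem_R: "Suc k \<in> set r" if "r \<in> R" for r
    using that words_Suc_iff by (auto simp: R_def)
  have Min_unused: "Min ({1..Suc k} - set r) \<in> {1..Suc k} - set r" if "r \<in> R" for r
  proof (rule Min_in)
    have "card (set r) < card {1..Suc k}"
      using that card_length[of r] by (auto simp: R_def words_def)
    then show "{1..Suc k} - set r \<noteq> {}"
      by (metis Diff_eq_empty_iff List.finite_set card_mono not_le)
  qed simp
  have W_eq: "W = W1 \<union> (W2 \<union> f ` R)"
  proof (intro equalityI subsetI)
    fix q assume q: "q \<in> W"
    show "q \<in> W1 \<union> (W2 \<union> f ` R)"
    proof (cases "Suc k \<in> set q")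
      case False
      then show ?thesis using q by (simp add: W1_def)
    next
      case True
      then obtain r x where rx: "q = r @ [x]" by (cases q rule: rev_cases) auto
      have g: "greedy {1..Suc k} r" "x \<in> {1..Suc k} - set r"
        "(\<forall>b\<in>set r. b < x) \<or> (\<forall>b\<in>{1..Suc k} - set r. x \<le> b)"
        using q rx by (auto simp: W_def words_def greedy_snoc)
      have r: "r \<in> words (Suc k) (Suc m)"
        using q rx g(1) by (auto simp: W_def words_def)
      show ?thesis
      proof (cases "x = Suc k")
        case True
        then show ?thesis using g(2) r rx words_Suc_iff by (auto simp: W2_def)
      next
        case False
        then have s: "Suc k \<in> set r" using \<open>Suc k \<in> set q\<close> rx by auto
        then have "r \<in> R" using r not_in_words by (auto simp: R_def)
        moreover have "\<forall>b\<in>{1..Suc k} - set r. x \<le> b"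
          using g s by fastforce
        then have "Min ({1..Suc k} - set r) = x"
          using g(2) by (intro Min_eqI) auto
        ultimately show ?thesis using rx by (auto simp: f_def)
      qed
    qed
  next
    fix q assume "q \<in> W1 \<union> (W2 \<union> f ` R)"
    then consider "q \<in> W1" | r where "r \<in> words k m" "q = r @ [Suc k]"
      | r where "r \<in> R" "q = f r" by (auto simp: W2_def)
    then show "q \<in> W"
    proof cases
      case 1
      then show ?thesis by (simp add: W1_def)
    next
      case 2
      then have "greedy {1..k} r" by (simp add: words_def)
      then have "greedy {1..Suc k} r" "\<forall>b\<in>set r. b < Suc k"
        using not_in_words[OF 2(1)] greedy_Suc_iff
        by (blast, auto simp: greedy_def less_Suc_eq_le)
      then show ?thesis using 2 not_in_words[OF 2(1)]
        by (auto simp: W_def words_def greedy_snoc simp del: One_nat_def)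
    next
      case 3
      have "\<forall>b\<in>{1..Suc k} - set r. Min ({1..Suc k} - set r) \<le> b"
        by (intro ballI Min_le) auto
      then show ?thesis using 3 Min_unused[OF 3(1)]
        by (auto simp: W_def words_def greedy_snoc f_def R_def)
    qed
  qed
  have fin: "finite W1" "finite W2" "finite R"
    by (auto simp: W1_def W_def W2_def R_def finite_words)
  have disj: "W1 \<inter> (W2 \<union> f ` R) = {}" "W2 \<inter> f ` R = {}"
    using mem_R Min_unused by (force simp: W1_def W2_def f_def)+
  have S1: "(\<Sum>q\<in>W1. t ^ lmax q) = (if m = 0 then 0 else weight t k (m - 1))"
  proof (cases m)
    case 0
    \<comment> \<open>With \<open>m = 0\<close> every value is used, so no word omits
      \<open>Suc k\<close>.\<close>
    have "W1 = {}"
    proof (rule ccontr)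
      assume "W1 \<noteq> {}"
      then obtain q where "Suc k \<notin> set q" "greedy {1..Suc k} q" "length q = Suc k"
        using 0 by (auto simp: W1_def W_def words_def)
      then have "distinct q" "set q \<subseteq> {1..k}" "length q = Suc k"
        using greedy_Suc_iff by (auto simp: greedy_def le_Suc_eq)
      then show False
        using card_mono[of "{1..k}" "set q"] by (simp add: distinct_card)
    qed
    then show ?thesis using 0 by simp
  next
    case (Suc m')
    then have "W1 = words k m'"
      using words_Suc_iff not_in_words by (auto simp: W1_def W_def)
    then show ?thesis using Suc by (simp add: weight_def)
  qed
  have "(\<Sum>q\<in>W2. t ^ lmax q) = (\<Sum>q\<in>words k m. t ^ lmax (q @ [Suc k]))"
    unfolding W2_def by (subst sum.reindex) (auto simp: inj_on_def)
  also have "\<dots> = (\<Sum>q\<in>words k m. t * t ^ lmax q)"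
  proof (rule sum.cong)
    fix q assume "q \<in> words k m"
    then have "\<forall>b\<in>set q. b < Suc k" by (auto simp: words_def greedy_def less_Suc_eq_le)
    then show "t ^ lmax (q @ [Suc k]) = t * t ^ lmax q"
      by (simp add: lmax_append_max)
  qed simp
  finally have S2: "(\<Sum>q\<in>W2. t ^ lmax q) = t * weight t k m"
    by (simp add: weight_def sum_distrib_left)
  have "(\<Sum>q\<in>f ` R. t ^ lmax q) = (\<Sum>q\<in>R. t ^ lmax (f q))"
    by (subst sum.reindex) (auto simp: inj_on_def f_def)
  also have "\<dots> = (\<Sum>q\<in>R. t ^ lmax q)"
  proof (rule sum.cong)
    fix q assume q: "q \<in> R"
    then have "Min ({1..Suc k} - set q) \<le> Suc k" using Min_unused by fastforce
    then show "t ^ lmax (f q) = t ^ lmax q"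
      unfolding f_def using lmax_snoc_not_max[OF mem_R[OF q]] by simp
  qed simp
  also have "\<dots> = weight t (Suc k) (Suc m) - weight t k m"
  proof -
    have "words k m \<subseteq> words (Suc k) (Suc m)"
      using words_Suc_iff not_in_words by blast
    then show ?thesis
      unfolding R_def weight_def by (simp add: sum_diff finite_words)
  qed
  finally have S3: "(\<Sum>q\<in>f ` R. t ^ lmax q) = weight t (Suc k) (Suc m) - weight t k m" .
  have "weight t (Suc k) m = (\<Sum>q\<in>W1. t ^ lmax q) + ((\<Sum>q\<in>W2. t ^ lmax q) + (\<Sum>q\<in>f ` R. t ^ lmax q))"
    unfolding weight_def W_def[symmetric] W_eq
    using fin disj by (simp add: sum.union_disjoint)
  then show ?thesis by (simp add: S1 S2 S3)
qed

lemma weight_0_0: "weight t 0 0 = 1"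
proof -
  have "words 0 0 = {[]}" by (auto simp: words_def greedy_def)
  then show ?thesis by (simp add: weight_def lmax_def)
qed

section \<open>Words that can follow the maximum, and splitting at the maximum\<close>

definition extremal :: "nat set \<Rightarrow> nat list set" where
  "extremal V = {r \<in> permutations_of_set V.
     \<forall>u a v. r = u @ a # v \<longrightarrow> (\<forall>b\<in>set v. a < b) \<or> (\<forall>b\<in>set v. b < a)}"

lemma Cons_in_extremal_iff:
  "a # r \<in> extremal V \<longleftrightarrow>
     a \<in> V \<and> r \<in> extremal (V - {a}) \<and> ((\<forall>b\<in>V - {a}. a < b) \<or> (\<forall>b\<in>V - {a}. b < a))"
proof -
  have "a # r \<in> permutations_of_set V \<longleftrightarrow> a \<in> V \<and> r \<in> permutations_of_set (V - {a})"
    by (auto simp: permutations_of_set_def)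
  moreover have "r \<in> permutations_of_set (V - {a}) \<Longrightarrow> set r = V - {a}"
    by (simp add: permutations_of_set_def)
  moreover have "(\<forall>u a' v. a # r = u @ a' # v \<longrightarrow> P a' v) \<longleftrightarrow>
      P a r \<and> (\<forall>u a' v. r = u @ a' # v \<longrightarrow> P a' v)" for P
    by (auto simp: Cons_eq_append_conv)
  ultimately show ?thesis by (auto simp: extremal_def)
qed

lemma extremal_empty: "extremal {} = {[]}"
  by (auto simp: extremal_def)

definition num_extremal :: "nat \<Rightarrow> nat" where
  "num_extremal m = (if m = 0 then 1 else 2 ^ (m - 1))"

lemma finite_extremal: "finite V \<Longrightarrow> finite (extremal V)"
  by (simp add: extremal_def)

text \<open>Each entry is the minimum or the maximum of what remains: a choice of two until one
  value is left and both coincide, hence the exponent \<open>m - 1\<close>.\<close>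

lemma card_extremal:
  "finite V \<Longrightarrow> card (extremal V) = num_extremal (card V)"
proof (induction "card V" arbitrary: V)
  case 0
  then show ?case by (simp add: extremal_empty num_extremal_def)
next
  case (Suc m)
  then have ne: "V \<noteq> {}" by auto
  define a where "a = Min V"
  define b where "b = Max V"
  have ab: "a \<in> V" "b \<in> V" "\<And>x. x \<in> V \<Longrightarrow> a \<le> x" "\<And>x. x \<in> V \<Longrightarrow> x \<le> b"
    using Suc.prems ne by (auto simp: a_def b_def)
  have *: "(c \<in> V \<and> ((\<forall>x\<in>V - {c}. c < x) \<or> (\<forall>x\<in>V - {c}. x < c))) \<longleftrightarrow> c = a \<or> c = b" for c
    using ab by (metis Diff_iff empty_iff insert_iff le_neq_implies_less leD)
  have eq: "extremal V = (#) a ` extremal (V - {a}) \<union> (#) b ` extremal (V - {b})" (is "_ = ?R")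
  proof (intro set_eqI)
    fix r show "r \<in> extremal V \<longleftrightarrow> r \<in> ?R"
    proof (cases r)
      case Nil
      then show ?thesis using ne by (auto simp: extremal_def permutations_of_set_def)
    next
      case (Cons c s)
      then show ?thesis using *[of c] Cons_in_extremal_iff[of c s V] by auto
    qed
  qed
  have c1: "card (extremal (V - {c})) = num_extremal m" if "c \<in> V" for c
  proof -
    have "m = card (V - {c})"
      using that Suc.hyps(2) by (metis card_Diff_singleton diff_Suc_1)
    then show ?thesis using Suc.hyps(1) Suc.prems by (metis finite_Diff)
  qed
  show ?case
  proof (cases m)
    case 0
    then have "a = b" using Suc.hyps(2) ab
      by (metis One_nat_def card_1_singletonE singletonD)
    then show ?thesis
      using eq c1[OF ab(1)] Suc.hyps(2) 0 by (simp add: card_image num_extremal_def)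
  next
    case (Suc m')
    have "a \<noteq> b"
    proof
      assume "a = b"
      then have "V \<subseteq> {a}" using ab by fastforce
      then show False using Suc \<open>Suc m = card V\<close> card_mono[of "{a}" V] by simp
    qed
    then have "card (extremal V) = card (extremal (V - {a})) + card (extremal (V - {b}))"
      unfolding eq using \<open>finite V\<close>
      by (subst card_Un_disjoint) (auto simp: card_image finite_extremal)
    then show ?thesis
      using c1 ab Suc \<open>Suc m = card V\<close>[symmetric] by (simp add: num_extremal_def)
  qed
qed

text \<open>An entry of \<open>q\<close> has \<open>Suc k\<close> after it, so it cannot exceed
  everything after it; an entry of \<open>r\<close> has \<open>Suc k\<close> before it, so it is no
  left-to-right maximum. Striking out the impossible alternative leaves \<open>greedy\<close> and
  \<open>extremal\<close>.\<close>

lemma append_Cons_in_Av_iff: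
  assumes "Suc k \<notin> set q"
  shows "q @ Suc k # r \<in> Av T1 (Suc k) \<longleftrightarrow>
    greedy {1..k} q \<and> r \<in> extremal ({1..k} - set q)"
proof -
  let ?\<sigma> = "q @ Suc k # r"
  have perm: "?\<sigma> \<in> permutations_of_set {1..Suc k} \<longleftrightarrow>
      distinct q \<and> set q \<subseteq> {1..k} \<and> r \<in> permutations_of_set ({1..k} - set q)"
  proof -
    have "{1..Suc k} = insert (Suc k) {1..k}" by auto
    moreover have "Suc k \<notin> {1..k}" by simp
    ultimately show ?thesis
      using assms unfolding permutations_of_set_def
      by (simp only: mem_Collect_eq set_append list.set distinct_append distinct.simps) blast
  qed
  show ?thesis
  proof (cases "?\<sigma> \<in> permutations_of_set {1..Suc k}")
    case False
    then show ?thesis using perm by (auto simp: Av_def greedy_def extremal_def)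
  next
    case True
    then have d: "distinct ?\<sigma>" by (simp add: permutations_of_set_def)
    have q: "distinct q" "set q \<subseteq> {1..k}" "r \<in> permutations_of_set ({1..k} - set q)"
      using True perm by auto
    then have r: "set r = {1..k} - set q" by (simp add: permutations_of_set_def)
    let ?A = "\<lambda>u a v. (\<forall>b\<in>set u. b < a) \<or> (\<forall>b\<in>set v. a < b) \<or> (\<forall>b\<in>set v. b < (a::nat))"
    \<comment> \<open>The examined entry lies in \<open>q\<close>, is the maximum, or lies in
      \<open>r\<close>.\<close>
    have "(\<forall>u a v. ?\<sigma> = u @ a # v \<longrightarrow> ?A u a v) \<longleftrightarrow>
      (\<forall>u a v. q = u @ a # v \<longrightarrow> ?A u a (v @ Suc k # r)) \<and> ?A q (Suc k) r \<and>
      (\<forall>u a v. r = u @ a # v \<longrightarrow> ?A (q @ Suc k # u) a v)"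
    proof (intro iffI conjI allI impI)
      fix u a v
      assume H: "(\<forall>u a v. q = u @ a # v \<longrightarrow> ?A u a (v @ Suc k # r)) \<and> ?A q (Suc k) r \<and>
          (\<forall>u a v. r = u @ a # v \<longrightarrow> ?A (q @ Suc k # u) a v)"
        and e: "?\<sigma> = u @ a # v"
      from e consider v' where "q = u @ a # v'" "v = v' @ Suc k # r"
        | "u = q" "a = Suc k" "v = r" | u' where "u = q @ Suc k # u'" "r = u' @ a # v"
        by (auto simp: append_eq_append_conv2 append_eq_Cons_conv Cons_eq_append_conv)
      then show "?A u a v" by cases (use H in blast)+
    next
      fix u a v
      assume "\<forall>u a v. ?\<sigma> = u @ a # v \<longrightarrow> ?A u a v" "r = u @ a # v"
      then show "?A (q @ Suc k # u) a v" by (metis append.assoc append_Cons)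
    next
      fix u a v
      assume "\<forall>u a v. ?\<sigma> = u @ a # v \<longrightarrow> ?A u a v" "q = u @ a # v"
      then show "?A u a (v @ Suc k # r)" by (metis append.assoc append_Cons)
    qed blast
    moreover have "?A u a (v @ Suc k # r) \<longleftrightarrow> (\<forall>b\<in>set u. b < a) \<or> (\<forall>b\<in>{1..k} - set u. a \<le> b)"
      if "q = u @ a # v" for u a v
    proof -
      have "a < Suc k" using q(2) that by auto
      moreover have "{1..k} - set u = insert a (set v \<union> set r)"
        using q r that by auto
      moreover have "a \<notin> set v \<union> set r" using d that by auto
      ultimately show ?thesis by (auto simp: order_le_less)
    qed
    moreover have "?A q (Suc k) r" using q(2) by (auto simp: less_Suc_eq_le)
    moreover have "?A (q @ Suc k # u) a v \<longleftrightarrow> (\<forall>b\<in>set v. a < b) \<or> (\<forall>b\<in>set v. b < a)"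
      if "r = u @ a # v" for u a v
    proof -
      have "a \<in> set r" using that by simp
      then have "\<not> Suc k < a" unfolding r by simp
      then show ?thesis by auto
    qed
    ultimately show ?thesis
      using q True avoids_T1_iff[OF d] by (simp add: Av_def greedy_def extremal_def)
  qed
qed

lemma pos_append_max:
  assumes "Suc k \<notin> set q" "Suc k \<notin> set r" "set (q @ Suc k # r) = {1..Suc k}"
  shows "pos (q @ Suc k # r) = Suc (length q)"
proof -
  have "Max (set (q @ Suc k # r)) = Suc k"
    unfolding assms(3) by (rule Max_eqI) auto
  moreover have "(THE i. i < length (q @ Suc k # r) \<and> (q @ Suc k # r) ! i = Suc k) = length q"
  proof (rule the_equality)
    fix i assume "i < length (q @ Suc k # r) \<and> (q @ Suc k # r) ! i = Suc k"
    then show "i = length q"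
      using assms(1,2) by (auto simp: nth_append nth_Cons' in_set_conv_nth split: if_splits)
  qed simp
  ultimately show ?thesis by (simp add: pos_def)
qed

lemma Av_max_decomp:
  assumes "\<sigma> \<in> Av T1 (Suc k)"
  obtains q r where "\<sigma> = q @ Suc k # r" "Suc k \<notin> set q" "Suc k \<notin> set r"
    "pos \<sigma> = Suc (length q)" "lmax \<sigma> = Suc (lmax q)" "length q + length r = k"
proof -
  have p: "distinct \<sigma>" "set \<sigma> = {1..Suc k}"
    using assms by (auto simp: Av_def permutations_of_set_def)
  then obtain q r where s: "\<sigma> = q @ Suc k # r"
    by (metis atLeastAtMost_iff le_refl le_add1 plus_1_eq_Suc split_list)
  have n: "Suc k \<notin> set q" "Suc k \<notin> set r" using p s by auto
  have "x < Suc k" if "x \<in> set q \<union> set r" for x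
  proof -
    have "x \<in> {1..Suc k}" using that p(2) s by auto
    moreover have "x \<noteq> Suc k" using that n by auto
    ultimately show ?thesis by auto
  qed
  then have "lmax \<sigma> = Suc (lmax q)" unfolding s by (intro lmax_append_max) auto
  moreover have "pos \<sigma> = Suc (length q)"
    unfolding s using n p s by (intro pos_append_max) auto
  moreover have "length \<sigma> = Suc k" using distinct_card[OF p(1)] p(2) by simp
  ultimately show ?thesis using that s n by auto
qed

text \<open>\<open>m\<close> counts the entries after the maximum. Both statistics depend only on
  the prefix, so the suffix contributes the factor \<open>num_extremal m\<close>; the extra
  \<open>t\<close> stands for the maximum itself.\<close>

lemma sum_Av_pos:
  fixes y t :: "'a :: comm_ring_1"
  assumes "m \<le> k"
  shows "(\<Sum>\<sigma> | \<sigma> \<in> Av T1 (Suc k) \<and> pos \<sigma> + m = Suc k. y ^ pos \<sigma> * t ^ lmax \<sigma>) =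
    of_nat (num_extremal m) * (y ^ (Suc k - m) * t * weight t k m)"
proof -
  define f where "f = (\<lambda>(q, r). q @ Suc k # r)"
  define D where "D = Sigma (words k m) (\<lambda>q. extremal ({1..k} - set q))"
  have D: "Suc k \<notin> set q" "Suc k \<notin> set r" "f (q, r) \<in> Av T1 (Suc k)"
    "length q + m = k" if "(q, r) \<in> D" for q r
  proof -
    show "Suc k \<notin> set q" using that not_in_words by (auto simp: D_def)
    then show "f (q, r) \<in> Av T1 (Suc k)"
      using that append_Cons_in_Av_iff by (auto simp: D_def words_def f_def)
    show "Suc k \<notin> set r" "length q + m = k"
      using that by (auto simp: D_def extremal_def permutations_of_set_def words_def)
  qed
  \<comment> \<open>All prefixes in \<open>D\<close> have length \<open>k - m\<close>, so the
    permutation determines its split.\<close>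
  have inj: "inj_on f D"
  proof (rule inj_onI, clarify)
    fix q r q' r'
    assume a: "(q, r) \<in> D" "(q', r') \<in> D" "f (q, r) = f (q', r')"
    then show "q = q' \<and> r = r'"
      using D(4)[OF a(1)] D(4)[OF a(2)] by (auto simp: f_def)
  qed
  have stat: "pos (f (q, r)) = Suc (length q) \<and> lmax (f (q, r)) = Suc (lmax q)"
    if qr: "(q, r) \<in> D" for q r
  proof (rule Av_max_decomp[OF D(3)[OF qr]])
    fix q' r'
    assume a: "f (q, r) = q' @ Suc k # r'" "Suc k \<notin> set q'" "Suc k \<notin> set r'"
      "pos (f (q, r)) = Suc (length q')" "lmax (f (q, r)) = Suc (lmax q')"
    have "q = q'"
      using a(1-3) D(1,2)[OF qr] by (auto simp: f_def append_Cons_eq_iff)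
    then show ?thesis using a by simp
  qed
  have img: "{\<sigma> \<in> Av T1 (Suc k). pos \<sigma> + m = Suc k} = f ` D"
  proof (intro equalityI subsetI)
    fix \<sigma> assume a: "\<sigma> \<in> {\<sigma> \<in> Av T1 (Suc k). pos \<sigma> + m = Suc k}"
    then have "\<sigma> \<in> Av T1 (Suc k)" by simp
    then obtain q r where s: "\<sigma> = q @ Suc k # r" "Suc k \<notin> set q" "pos \<sigma> = Suc (length q)"
      by (rule Av_max_decomp)
    then have "(q, r) \<in> D"
      using a append_Cons_in_Av_iff[OF s(2), of r] by (auto simp: D_def words_def)
    then show "\<sigma> \<in> f ` D" using s by (force simp: f_def)
  next
    fix \<sigma> assume "\<sigma> \<in> f ` D"
    then show "\<sigma> \<in> {\<sigma> \<in> Av T1 (Suc k). pos \<sigma> + m = Suc k}"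
      using D(3,4) stat by fastforce
  qed
  have "(\<Sum>\<sigma> | \<sigma> \<in> Av T1 (Suc k) \<and> pos \<sigma> + m = Suc k. y ^ pos \<sigma> * t ^ lmax \<sigma>) =
      (\<Sum>(q, r)\<in>D. y ^ (Suc k - m) * (t * t ^ lmax q))"
    unfolding img sum.reindex[OF inj]
  proof (rule sum.cong)
    fix z assume "z \<in> D"
    then show "((\<lambda>\<sigma>. y ^ pos \<sigma> * t ^ lmax \<sigma>) \<circ> f) z =
        (case z of (q, r) \<Rightarrow> y ^ (Suc k - m) * (t * t ^ lmax q))"
      using stat D(4) by (cases z) (fastforce simp: Suc_diff_le)
  qed simp
  also have "\<dots> = (\<Sum>q\<in>words k m. \<Sum>r\<in>extremal ({1..k} - set q). y ^ (Suc k - m) * (t * t ^ lmax q))"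
    unfolding D_def by (subst sum.Sigma) (auto simp: finite_words finite_extremal)
  also have "\<dots> = (\<Sum>q\<in>words k m. of_nat (num_extremal m) * (y ^ (Suc k - m) * (t * t ^ lmax q)))"
  proof (rule sum.cong)
    fix q assume "q \<in> words k m"
    then have "card ({1..k} - set q) = m"
      by (auto simp: words_def greedy_def card_Diff_subset distinct_card)
    then show "(\<Sum>r\<in>extremal ({1..k} - set q). y ^ (Suc k - m) * (t * t ^ lmax q)) =
        of_nat (num_extremal m) * (y ^ (Suc k - m) * (t * t ^ lmax q))"
      by (simp add: card_extremal)
  qed simp
  finally show ?thesis
    by (simp add: weight_def sum_distrib_left mult.assoc)
qed

section \<open>The series \<open>C_m\<close>, here \<open>D (Suc m)\<close>, and their geometric
  progression\<close>

text \<open>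
  For \<open>m > 0\<close>, \<open>D m\<close> counts the permutations with \<open>m - 1\<close> entries after the maximum, up to
  reordering these entries; \<open>D 0 = y w\<close> makes the recurrence below hold from the start.
\<close>

definition D :: "nat \<Rightarrow> fps3" where
  "D m = (if m = 0 then yw else Abs_fps (\<lambda>n. if n = 0 then 0 else
     varY ^ (Suc n - m) * varW * weight varW (n - 1) (m - 1)))"

lemma D_0: "D 0 = yw"
  by (simp add: D_def)

lemma D_Suc_nth_Suc:
  "fps_nth (D (Suc m)) (Suc k) = varY ^ (Suc k - m) * varW * weight varW k m"
  by (simp add: D_def)

lemma D_Suc_nth_eq_0: "n \<le> m \<Longrightarrow> fps_nth (D (Suc m)) n = 0"
  by (cases n) (auto simp: D_def weight_eq_0)

text \<open>From \<open>x^2\<close> on, the coefficients are \<open>weight_Suc\<close> times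
  \<open>y^(k+2-m) w\<close>, with the subtracted term moved to the left.\<close>

lemma D_recurrence:
  "D (Suc m) + fps_const varY * (fps_X * D (Suc m)) =
   fps_X * D m + fps_const (varY * varW) * (fps_X * D (Suc m)) + fps_const varY * D (Suc (Suc m))"
proof (rule fps_ext)
  fix n
  consider "n = 0" | "n = 1" | k where "n = Suc (Suc k)"
    by (metis One_nat_def not0_implies_Suc)
  then show "fps_nth (D (Suc m) + fps_const varY * (fps_X * D (Suc m))) n =
    fps_nth (fps_X * D m + fps_const (varY * varW) * (fps_X * D (Suc m))
      + fps_const varY * D (Suc (Suc m))) n"
  proof cases
    case 1
    then show ?thesis by (simp add: D_Suc_nth_eq_0)
  next
    case 2
    show ?thesis
    proof (cases m)
      case 0
      \<comment> \<open>The coefficient \<open>y w\<close> comes from the empty word on the left and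
        from \<open>D 0\<close> on the right.\<close>
      then show ?thesis using 2 D_Suc_nth_Suc[of 0 0]
        by (simp add: D_0 yw_def D_Suc_nth_eq_0 weight_0_0)
    next
      case (Suc m')
      then show ?thesis using 2 by (simp add: D_Suc_nth_eq_0)
    qed
  next
    case 3
    \<comment> \<open>All terms are given the common factor
      \<open>varY ^ (Suc (Suc k) - m) * varW\<close>. Where \<open>m > k\<close> makes truncated
      exponents disagree, the weight is zero.\<close>
    have e1: "fps_nth (D m) (Suc k) = (if m = 0 then 0 else
        varY ^ (Suc (Suc k) - m) * varW * weight varW k (m - 1))"
      by (cases m) (simp_all add: D_0 yw_def D_Suc_nth_Suc)
    have e2: "varY * fps_nth (D (Suc m)) (Suc k) =
        varY ^ (Suc (Suc k) - m) * varW * weight varW k m"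
      by (cases "m \<le> k") (simp_all add: D_Suc_nth_Suc Suc_diff_le weight_eq_0)
    have e3: "varY * fps_nth (D (Suc (Suc m))) (Suc (Suc k)) =
        varY ^ (Suc (Suc k) - m) * varW * weight varW (Suc k) (Suc m)"
      by (cases "m \<le> k") (simp_all add: D_Suc_nth_Suc Suc_diff_le weight_eq_0)
    have e4: "varY * varW * fps_nth (D (Suc m)) (Suc k) =
        varY ^ (Suc (Suc k) - m) * varW * (varW * weight varW k m)"
      using e2 by (simp add: algebra_simps)
    have e5: "fps_nth (D (Suc m)) (Suc (Suc k)) =
        varY ^ (Suc (Suc k) - m) * varW * weight varW (Suc k) m"
      by (simp add: D_Suc_nth_Suc)
    show ?thesis
      unfolding 3
      by (simp add: e1 e2 e3 e4 e5 weight_Suc[of _ k m] distrib_left right_diff_distrib)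
  qed
qed

text \<open>
  The defect \<open>E m\<close> satisfies the linear recurrence of \<open>D\<close> and \<open>E 0 = 0\<close>. Modulo lower order
  terms in \<open>x\<close> the recurrence reads \<open>E m = y * E (m + 1)\<close>, and \<open>E m\<close> has order at least \<open>m\<close>.
\<close>

lemma D_geometric: "D 1 * D m = yw * D (Suc m)"
proof -
  define E where "E m = D 1 * D m - yw * D (Suc m)" for m
  have E0: "E 0 = 0" by (simp add: E_def D_0)
  \<comment> \<open>The recurrence at \<open>m\<close> times \<open>D 1\<close>, minus the
    recurrence at \<open>Suc m\<close> times \<open>yw\<close>.\<close>
  have rec: "E (Suc m) = fps_X * E m + fps_const (varY * varW) * (fps_X * E (Suc m))
      + fps_const varY * E (Suc (Suc m)) - fps_const varY * (fps_X * E (Suc m))" for m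
    using D_recurrence[of m] D_recurrence[of "Suc m"] unfolding E_def by algebra
  have high: "fps_nth (E (Suc m)) n = 0" if "n \<le> m" for m n
    using that by (simp add: E_def yw_def fps_mult_nth D_Suc_nth_eq_0)
  \<comment> \<open>Induction on the exponent of \<open>x\<close>, for all \<open>m\<close> at once:
    terms with a factor \<open>x\<close> involve only coefficients already known to vanish.\<close>
  have "fps_nth (E m) n = 0" for n
  proof (induction n arbitrary: m rule: less_induct)
    case (less n)
    have lower: "fps_nth (fps_X * E m) n = 0" for m
      using less.IH by simp
    have step: "fps_nth (E (Suc m)) n = varY * fps_nth (E (Suc (Suc m))) n" for m
      by (subst rec) (simp add: lower del: fps_X_mult_nth)
    have "fps_nth (E (Suc m)) n = varY ^ i * fps_nth (E (Suc (m + i))) n" for m i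
      by (induction i) (simp_all add: step[of "m + _"])
    \<comment> \<open>Taking \<open>i = n\<close> reaches the index \<open>Suc (m + n)\<close>,
      where \<open>high\<close> applies.\<close>
    from this[of _ n] have "fps_nth (E (Suc m)) n = 0" for m
      by (simp add: high)
    then show ?case using E0 by (cases m) auto
  qed
  then have "E m = 0" by (intro fps_ext) simp
  then show ?thesis by (simp add: E_def)
qed

section \<open>The series \<open>B\<close> and \<open>J\<close>\<close>

lemma Av_pos_eq_iff:
  assumes "\<sigma> \<in> Av T1 (Suc k)"
  shows "\<sigma> ! k = Suc k \<longleftrightarrow> pos \<sigma> = Suc k"
proof (rule Av_max_decomp[OF assms])
  fix q r
  assume a: "\<sigma> = q @ Suc k # r" "Suc k \<notin> set r" "pos \<sigma> = Suc (length q)" "length q + length r = k"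
  show ?thesis
  proof (cases r rule: rev_cases)
    case Nil
    then show ?thesis using a by auto
  next
    case (snoc r' z)
    then have "\<sigma> ! k = z" using a by (auto simp: nth_append nth_Cons')
    then show ?thesis using a snoc by auto
  qed
qed

text \<open>The case \<open>m = 0\<close> of \<open>sum_Av_pos\<close>: nothing follows the
  maximum.\<close>

lemma B_eq: "B = D 1"
proof (rule fps_ext)
  fix n
  show "fps_nth B n = fps_nth (D 1) n"
  proof (cases n)
    case 0
    then show ?thesis by (simp add: B_def gf_def D_def)
  next
    case (Suc k)
    have "{\<sigma> \<in> Av T1 (Suc k). \<sigma> ! k = Suc k} = {\<sigma> \<in> Av T1 (Suc k). pos \<sigma> + 0 = Suc k}"
      using Av_pos_eq_iff by auto
    then show ?thesis
      using sum_Av_pos[of 0 k varY varW] D_Suc_nth_Suc[of 0 k]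
      by (simp add: B_def gf_def Suc num_extremal_def)
  qed
qed

text \<open>Permutations are grouped by the number \<open>m\<close> of entries after the maximum. A
  finite sum stands in for the infinite one, since \<open>D (Suc m)\<close> has no
  \<open>x^n\<close> term for \<open>m \<ge> n\<close>.\<close>

lemma J_nth: "n \<le> M \<Longrightarrow>
  fps_nth J n = fps_nth (\<Sum>m<M. of_nat (num_extremal m) * D (Suc m)) n"
proof (cases n)
  case 0
  then show ?thesis by (simp add: J_def gf_def fps_sum_nth D_Suc_nth_eq_0)
next
  case (Suc k)
  assume "n \<le> M"
  have "fps_nth J n = (\<Sum>\<sigma>\<in>Av T1 (Suc k). varY ^ pos \<sigma> * varW ^ lmax \<sigma>)"
    by (simp add: J_def gf_def Suc)
  also have "\<dots> = (\<Sum>m\<le>k. \<Sum>\<sigma> | \<sigma> \<in> Av T1 (Suc k) \<and> Suc k - pos \<sigma> = m. varY ^ pos \<sigma> * varW ^ lmax \<sigma>)"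
  proof (rule sum.group[symmetric])
    show "(\<lambda>\<sigma>. Suc k - pos \<sigma>) ` Av T1 (Suc k) \<subseteq> {..k}"
      by (auto simp: pos_def)
  qed (auto simp: Av_def)
  also have "\<dots> = (\<Sum>m\<le>k. \<Sum>\<sigma> | \<sigma> \<in> Av T1 (Suc k) \<and> pos \<sigma> + m = Suc k. varY ^ pos \<sigma> * varW ^ lmax \<sigma>)"
  proof (intro sum.cong refl Collect_cong conj_cong)
    fix m \<sigma>
    assume "\<sigma> \<in> Av T1 (Suc k)"
    then have "pos \<sigma> \<le> Suc k" by (rule Av_max_decomp) auto
    then show "Suc k - pos \<sigma> = m \<longleftrightarrow> pos \<sigma> + m = Suc k" by auto
  qed
  also have "\<dots> = (\<Sum>m\<le>k. of_nat (num_extremal m) * fps_nth (D (Suc m)) n)"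
    by (intro sum.cong) (auto simp: sum_Av_pos D_Suc_nth_Suc Suc)
  also have "\<dots> = (\<Sum>m<M. of_nat (num_extremal m) * fps_nth (D (Suc m)) n)"
    using \<open>n \<le> M\<close> Suc by (intro sum.mono_neutral_left) (auto simp: D_Suc_nth_eq_0)
  finally show ?thesis
    by (simp add: fps_sum_nth fps_of_nat[symmetric])
qed

lemma J_functional_equation: "yw * J = yw * B + B * (2 * J - B)"
proof (rule fps_ext)
  fix n
  define S where "S M = (\<Sum>m<M. of_nat (num_extremal m) * D (Suc m))" for M
  have S: "fps_nth J i = fps_nth (S M) i" if "i \<le> M" for i M
    using J_nth[OF that] by (simp add: S_def)
  have S_Suc: "S (Suc M) = B + (\<Sum>m<M. 2 ^ m * D (Suc (Suc m)))" for M
    unfolding S_def sum.lessThan_Suc_shift by (simp add: num_extremal_def B_eq)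
  \<comment> \<open>One step of the geometric progression: \<open>yw\<close> is traded for
    \<open>B\<close> while the index drops by one.\<close>
  have shift: "yw * (2 ^ m * D (Suc (Suc m))) = B * (2 ^ m * D (Suc m))" for m
    using D_geometric[of "Suc m"] unfolding B_eq by (metis mult.left_commute)
  have 1: "yw * S (Suc M) = yw * B + B * (\<Sum>m<M. 2 ^ m * D (Suc m))" for M
    by (simp only: S_Suc shift distrib_left sum_distrib_left)
  \<comment> \<open>Doubling turns \<open>num_extremal m\<close> into \<open>2 ^ m\<close> for
    \<open>m > 0\<close>, but counts the term \<open>B\<close> of \<open>m = 0\<close>
    twice.\<close>
  have 2: "(\<Sum>m<Suc M. 2 ^ m * D (Suc m)) = 2 * S (Suc M) - B" for M
    unfolding S_def sum.lessThan_Suc_shift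
    by (simp add: num_extremal_def B_eq distrib_left sum_distrib_left mult.assoc)
  \<comment> \<open>Equation \<open>1\<close> shortens the sum by one term and \<open>2\<close>
    keeps its length. Both lengths are at least \<open>n\<close>, so \<open>S\<close> agrees with
    \<open>J\<close> up to \<open>x^n\<close>.\<close>
  have "fps_nth (yw * J) n = fps_nth (yw * S (Suc (Suc n))) n"
    by (simp add: yw_def S[of n "Suc (Suc n)"])
  also have "\<dots> = fps_nth (yw * B) n + fps_nth (B * (2 * S (Suc n) - B)) n"
    unfolding 1 2 by simp
  also have "fps_nth (B * (2 * S (Suc n) - B)) n = fps_nth (B * (2 * J - B)) n"
    unfolding fps_mult_nth[of B]
    by (intro sum.cong) (simp_all add: S[of _ "Suc n"] numeral_fps_const)
  finally show "fps_nth (yw * J) n = fps_nth (yw * B + B * (2 * J - B)) n" by simp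
qed

theorem theorem10:
  shows "to_fract J = to_fract (B * (B - yw)) / to_fract (2 * B - yw)"
proof -
  \<comment> \<open>Collecting the terms in \<open>J\<close> gives an identity of power series; the
    division takes place only in the fraction field.\<close>
  have "J * (2 * B - yw) = B * (B - yw)"
    using J_functional_equation by algebra
  then have "to_fract J * to_fract (2 * B - yw) = to_fract (B * (B - yw))"
    by (metis to_fract_mult)
  then show ?thesis
    using denominator_nonzero
    by (simp add: eq_divide_eq del: to_fract_diff to_fract_mult)
qed

end
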